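(* Let $\mathbb{K}$ be an algebraically closed field of characteristic $\neq 2$ and let $\alpha_1,\alpha_2\in\mathbb{K}$. Any polynomial identity of the algebra $\left(\mathbb{K}^{2\times 2}\right)^3$ is a polynomial identity of $\mathcal{D}_3(\alpha_1,\alpha_2)$.
   Context: $\mathcal{D}_3(\alpha_1,\alpha_2)$ denotes the associative unital $\mathbb{K}$-algebra given by generators $a,b,c$ and relations $$a^2=b^2=c^2=\alpha_1,\qquad ca+bc+ab=\alpha_2,\qquad cb+ba+ac=\alpha_2.$$ A polynomial identity of a $\mathbb{K}$-algebra $A$ is an element $f(X_1,\dots,X_m)$ of a free associative $\mathbb{K}$-algebra $\mathbb{K}\langle X_1,\dots,X_m\rangle$ such that $f(x_1,\dots,x_m)=0$ for all $x_1,\dots,x_m\in A$. $\left(\mathbb{K}^{2\times 2}\right)^3$ is the direct product of three copies of the algebra of $2\times 2$ matrices over $\mathbb{K}$. *)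

theory Defs
  imports
    "HOL-Library.Poly_Mapping"
    "HOL-Library.FuncSet"
    "HOL-Computational_Algebra.Polynomial"
    "HOL-Algebra.QuotRing"
    "HOL-Algebra.Module"
    "Jordan_Normal_Form.Matrix"
begin

section \<open>Algebras over a field\<close>

text \<open>
  The scalars range over a type of class \<open>field\<close>; an algebra is a \<open>module\<close> record of HOL-Algebra.
  The library locale \<open>algebra\<close> covers commutative algebras only, hence this one.
\<close>

locale assoc_algebra = ring A for A :: "('k::field, 'a) module" (structure) +
  assumes smult_carrier: "x \<in> carrier A \<Longrightarrow> c \<odot> x \<in> carrier A"
    and smult_add_left: "x \<in> carrier A \<Longrightarrow> (c + d) \<odot> x = c \<odot> x \<oplus> d \<odot> x"
    and smult_add_right:
      "x \<in> carrier A \<Longrightarrow> y \<in> carrier A \<Longrightarrow> c \<odot> (x \<oplus> y) = c \<odot> x \<oplus> c \<odot> y"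
    and smult_smult: "x \<in> carrier A \<Longrightarrow> (c * d) \<odot> x = c \<odot> (d \<odot> x)"
    and smult_1: "x \<in> carrier A \<Longrightarrow> 1 \<odot> x = x"
    and smult_mult_left:
      "x \<in> carrier A \<Longrightarrow> y \<in> carrier A \<Longrightarrow> (c \<odot> x) \<otimes> y = c \<odot> (x \<otimes> y)"
    and smult_mult_right:
      "x \<in> carrier A \<Longrightarrow> y \<in> carrier A \<Longrightarrow> x \<otimes> (c \<odot> y) = c \<odot> (x \<otimes> y)"


section \<open>Free associative algebras\<close>

text \<open>
  A wrapper around lists that carries the monoid of words, written additively because the
  convolution product of \<open>poly_mapping\<close> is indexed by additive monoids.
\<close>

datatype 'v free_monoid = Monomial (letters: "'v list")

instantiation free_monoid :: (type) monoid_add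
begin

definition zero_free_monoid :: "'a free_monoid" where
  "0 = Monomial []"

definition plus_free_monoid :: "'a free_monoid \<Rightarrow> 'a free_monoid \<Rightarrow> 'a free_monoid" where
  "u + v = Monomial (letters u @ letters v)"

instance
  by standard (simp_all add: zero_free_monoid_def plus_free_monoid_def)

end

type_synonym ('v, 'k) nc_poly = "'v free_monoid \<Rightarrow>\<^sub>0 'k"

definition nc_const :: "'k::field \<Rightarrow> ('v, 'k) nc_poly" where
  "nc_const c = Poly_Mapping.single 0 c"

definition nc_var :: "'v \<Rightarrow> ('v, 'k::field) nc_poly" where
  "nc_var v = Poly_Mapping.single (Monomial [v]) 1"

definition free_algebra :: "'v set \<Rightarrow> ('k::field, ('v, 'k) nc_poly) module" where
  "free_algebra V =
     \<lparr>carrier = {f. \<forall>w\<in>Poly_Mapping.keys f. set (letters w) \<subseteq> V},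
      mult = (*), one = 1, zero = 0, add = (+),
      smult = (\<lambda>c f. nc_const c * f)\<rparr>"


section \<open>Quotients and direct products\<close>

text \<open>
  The scalar action sends the coset of \<open>x\<close> to the coset of \<open>c \<odot> x\<close>; the union makes this
  independent of a choice of representative (see \<open>smult_quot_algebra_coset\<close>).
\<close>

definition quot_algebra :: "('k::field, 'a) module \<Rightarrow> 'a set \<Rightarrow> ('k, 'a set) module" where
  "quot_algebra A I =
     \<lparr>carrier = carrier (A Quot I), mult = mult (A Quot I), one = one (A Quot I),
      zero = zero (A Quot I), add = add (A Quot I),
      smult = (\<lambda>c X. \<Union>x\<in>X. I +>\<^bsub>A\<^esub> (c \<odot>\<^bsub>A\<^esub> x))\<rparr>"

definition prod_algebra ::
  "'i set \<Rightarrow> ('i \<Rightarrow> ('k::field, 'a) module) \<Rightarrow> ('k, 'i \<Rightarrow> 'a) module" where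
  "prod_algebra I A =
     \<lparr>carrier = (\<Pi>\<^sub>E i\<in>I. carrier (A i)),
      mult = (\<lambda>x y. \<lambda>i\<in>I. x i \<otimes>\<^bsub>A i\<^esub> y i), one = (\<lambda>i\<in>I. \<one>\<^bsub>A i\<^esub>),
      zero = (\<lambda>i\<in>I. \<zero>\<^bsub>A i\<^esub>), add = (\<lambda>x y. \<lambda>i\<in>I. x i \<oplus>\<^bsub>A i\<^esub> y i),
      smult = (\<lambda>c x. \<lambda>i\<in>I. c \<odot>\<^bsub>A i\<^esub> x i)\<rparr>"


section \<open>Polynomial identities\<close>

definition nc_eval :: "('k::field, 'a) module \<Rightarrow> ('v \<Rightarrow> 'a) \<Rightarrow> ('v, 'k) nc_poly \<Rightarrow> 'a" where
  "nc_eval A x f =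
     finsum A (\<lambda>w. Poly_Mapping.lookup f w \<odot>\<^bsub>A\<^esub> foldr (\<lambda>v y. x v \<otimes>\<^bsub>A\<^esub> y) (letters w) \<one>\<^bsub>A\<^esub>)
       (Poly_Mapping.keys f)"

text \<open>The variables \<open>X\<^sub>1, \<dots>, X\<^sub>m\<close> are the naturals \<open>1, \<dots>, m\<close>.\<close>

definition polynomial_identity ::
  "nat \<Rightarrow> (nat, 'k::field) nc_poly \<Rightarrow> ('k, 'a) module \<Rightarrow> bool" where
  "polynomial_identity m f A \<longleftrightarrow>
     f \<in> carrier (free_algebra {1..m} :: ('k, (nat, 'k) nc_poly) module) \<and>
     (\<forall>x \<in> {1..m} \<rightarrow> carrier A. nc_eval A x f = \<zero>\<^bsub>A\<^esub>)"


section \<open>The algebra \<open>D\<^sub>3(\<alpha>\<^sub>1, \<alpha>\<^sub>2)\<close>\<close>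

datatype D3_gen = Gen_a | Gen_b | Gen_c

definition D3_relators :: "'k::field \<Rightarrow> 'k \<Rightarrow> (D3_gen, 'k) nc_poly set" where
  "D3_relators \<alpha>1 \<alpha>2 =
     (let a = nc_var Gen_a; b = nc_var Gen_b; c = nc_var Gen_c in
       {a * a - nc_const \<alpha>1, b * b - nc_const \<alpha>1, c * c - nc_const \<alpha>1,
        c * a + b * c + a * b - nc_const \<alpha>2,
        c * b + b * a + a * c - nc_const \<alpha>2})"

definition D3 :: "'k::field \<Rightarrow> 'k \<Rightarrow> ('k, (D3_gen, 'k) nc_poly set) module" where
  "D3 \<alpha>1 \<alpha>2 =
     (let F = free_algebra UNIV in quot_algebra F (genideal F (D3_relators \<alpha>1 \<alpha>2)))"


section \<open>The constructions yield algebras\<close>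

lemma ring_record_cong:
  fixes R :: "('a, 'r) ring_scheme" and S :: "('a, 's) ring_scheme"
  assumes "ring R"
    and eq: "carrier S = carrier R" "mult S = mult R" "one S = one R" "zero S = zero R"
      "add S = add R"
  shows "ring S"
proof -
  interpret R: ring R by fact
  show ?thesis
  proof (rule ringI)
    show "abelian_group S"
      by (rule abelian_groupI)
        (auto simp: eq R.a_assoc R.a_comm R.a_lcomm intro!: bexI[of _ "\<ominus>\<^bsub>R\<^esub> x" for x] R.l_neg)
    show "Group.monoid S"
      by (rule monoidI) (auto simp: eq R.m_assoc)
  qed (auto simp: eq R.l_distr R.r_distr)
qed

lemma keys_nc_times:
  fixes f g :: "('v, 'k::field) nc_poly"
  assumes "w \<in> Poly_Mapping.keys (f * g)"
  obtains u v where "u \<in> Poly_Mapping.keys f" "v \<in> Poly_Mapping.keys g" "w = u + v"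
  using keys_mult[of f g] assms by blast

lemma nc_const_commute:
  "f * nc_const c = nc_const c * (f :: ('v, 'k::field) nc_poly)"
proof (induction f rule: update_induct)
  case (update f a b)
  have "Poly_Mapping.update a b f = f + Poly_Mapping.single a b"
    using update(1) by (auto intro!: poly_mapping_eqI simp: lookup_update lookup_add lookup_single when_def in_keys_iff)
  then show ?case
    using update(3) by (simp add: distrib_left distrib_right nc_const_def mult_single mult.commute)
qed simp

lemma assoc_algebra_free_algebra:
  "assoc_algebra (free_algebra V :: ('k::field, ('v, 'k) nc_poly) module)"
proof -
  let ?F = "free_algebra V :: ('k, ('v, 'k) nc_poly) module"
  let ?C = "carrier ?F"
  have add_closed: "f + g \<in> ?C" if "f \<in> ?C" "g \<in> ?C" for f g
    using that Poly_Mapping.keys_add[of f g] by (auto simp: free_algebra_def)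
  have mult_closed: "f * g \<in> ?C" if fg: "f \<in> ?C" "g \<in> ?C" for f g
  proof -
    have "set (letters w) \<subseteq> V" if w: "w \<in> Poly_Mapping.keys (f * g)" for w
    proof -
      obtain u v where uv: "u \<in> Poly_Mapping.keys f" "v \<in> Poly_Mapping.keys g" "w = u + v"
        using w by (rule keys_nc_times)
      then have "set (letters u) \<subseteq> V" "set (letters v) \<subseteq> V"
        using fg by (auto simp: free_algebra_def)
      then show ?thesis using uv by (auto simp: plus_free_monoid_def)
    qed
    then show ?thesis by (simp add: free_algebra_def)
  qed
  have const_closed: "nc_const c \<in> ?C" for c
    by (auto simp: free_algebra_def nc_const_def zero_free_monoid_def split: if_splits)
  have one_closed: "1 \<in> ?C"
    using const_closed[of 1] by (simp add: nc_const_def)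
  have uminus_closed: "- f \<in> ?C" if "f \<in> ?C" for f
    using that by (auto simp: free_algebra_def in_keys_iff)
  have zero_closed: "0 \<in> ?C"
    by (simp add: free_algebra_def)
  have sm: "c \<odot>\<^bsub>?F\<^esub> f = nc_const c * f" "f \<otimes>\<^bsub>?F\<^esub> g = f * g" "f \<oplus>\<^bsub>?F\<^esub> g = f + g"
    "\<zero>\<^bsub>?F\<^esub> = 0" "\<one>\<^bsub>?F\<^esub> = 1" for c f g
    by (simp_all add: free_algebra_def)
  have r: "ring ?F"
  proof (rule ringI)
    show "abelian_group ?F"
    proof (rule abelian_groupI)
      fix f assume f: "f \<in> ?C"
      show "\<exists>g\<in>?C. g \<oplus>\<^bsub>?F\<^esub> f = \<zero>\<^bsub>?F\<^esub>"
        by (rule bexI[OF _ uminus_closed[OF f]]) (simp add: sm)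
    qed (simp_all add: sm add_closed zero_closed ac_simps)
    show "Group.monoid ?F"
      by (rule monoidI) (simp_all add: sm mult_closed one_closed mult.assoc)
  qed (simp_all add: sm distrib_left distrib_right)
  have add_const: "nc_const (c + d) = nc_const c + (nc_const d :: ('v, 'k) nc_poly)" for c d
    by (simp add: nc_const_def single_add)
  have mult_const: "nc_const (c * d) = nc_const c * (nc_const d :: ('v, 'k) nc_poly)" for c d
    by (simp add: nc_const_def mult_single)
  have const_1: "nc_const 1 = (1 :: ('v, 'k) nc_poly)"
    by (simp add: nc_const_def)
  have mult_right: "f * (nc_const c * g) = nc_const c * (f * g)"
    for c and f g :: "('v, 'k) nc_poly"
    by (metis nc_const_commute mult.assoc)
  show ?thesis
    by (intro assoc_algebra.intro assoc_algebra_axioms.intro r)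
      (simp_all add: sm mult_closed const_closed add_const mult_const const_1
        distrib_left distrib_right mult.assoc, rule mult_right)
qed

context assoc_algebra
begin

lemma smult_in_ideal:
  assumes "ideal I A" "x \<in> I"
  shows "c \<odot> x \<in> I"
proof -
  interpret I: ideal I A by fact
  have x: "x \<in> carrier A" using assms(2) I.Icarr by blast
  have "(c \<odot> \<one>) \<otimes> x \<in> I"
    by (rule I.I_l_closed) (use assms(2) smult_carrier in auto)
  then show ?thesis using x by (simp add: smult_mult_left)
qed

lemma smult_quot_algebra_coset:
  assumes "ideal I A" "x \<in> carrier A"
  shows "c \<odot>\<^bsub>quot_algebra A I\<^esub> (I +> x) = I +> (c \<odot> x)"
proof -
  interpret I: ideal I A by fact
  have *: "I +> (c \<odot> y) = I +> (c \<odot> x)" if y: "y \<in> I +> x" for y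
  proof -
    obtain h where h: "h \<in> I" "y = h \<oplus> x"
      using y by (auto simp: a_r_coset_def')
    have "c \<odot> y = (c \<odot> h) \<oplus> (c \<odot> x)"
      using h assms I.Icarr by (simp add: smult_add_right)
    then have "c \<odot> y \<in> I +> (c \<odot> x)"
      using smult_in_ideal[OF assms(1) h(1)] by (auto simp: a_r_coset_def')
    then show ?thesis
      using I.a_repr_independence' smult_carrier[OF assms(2)] by metis
  qed
  have "x \<in> I +> x"
    using I.a_rcos_self assms(2) by blast
  then have "(\<Union>y\<in>I +> x. I +> (c \<odot> y)) = I +> (c \<odot> x)"
    by (rule UN_constant_eq) (rule ballI, rule *)
  then show ?thesis by (simp add: quot_algebra_def)
qed

lemma assoc_algebra_quot_algebra:
  assumes I: "ideal I A"
  shows "assoc_algebra (quot_algebra A I)"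
proof -
  interpret I: ideal I A by fact
  let ?Q = "quot_algebra A I"
  have r: "ring ?Q"
    by (rule ring_record_cong[OF I.quotient_is_ring]) (simp_all add: quot_algebra_def)
  have rep: "\<exists>x\<in>carrier A. X = I +> x" if "X \<in> carrier ?Q" for X
    using that by (auto simp: quot_algebra_def FactRing_simps)
  have inC: "I +> x \<in> carrier ?Q" if "x \<in> carrier A" for x
    using that by (auto simp: quot_algebra_def FactRing_simps)
  have ad: "(I +> x) \<oplus>\<^bsub>?Q\<^esub> (I +> y) = I +> (x \<oplus> y)" if "x \<in> carrier A" "y \<in> carrier A" for x y
    using that by (simp add: quot_algebra_def FactRing_def I.a_rcos_sum)
  have mu: "(I +> x) \<otimes>\<^bsub>?Q\<^esub> (I +> y) = I +> (x \<otimes> y)" if "x \<in> carrier A" "y \<in> carrier A" for x y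
    using that by (simp add: quot_algebra_def FactRing_def I.rcoset_mult_add)
  note sm = smult_quot_algebra_coset[OF I]
  show ?thesis
    by (intro assoc_algebra.intro assoc_algebra_axioms.intro r)
      (auto dest!: rep simp: sm ad mu inC smult_carrier smult_add_left smult_add_right
        smult_smult smult_1 smult_mult_left smult_mult_right)
qed

end

lemma assoc_algebra_D3: "assoc_algebra (D3 \<alpha>1 \<alpha>2)"
proof -
  let ?F = "free_algebra UNIV :: ('a, (D3_gen, 'a) nc_poly) module"
  interpret F: assoc_algebra ?F by (rule assoc_algebra_free_algebra)
  show ?thesis
    unfolding D3_def Let_def
    by (intro F.assoc_algebra_quot_algebra F.genideal_ideal) (simp add: free_algebra_def)
qed

lemma assoc_algebra_prod_algebra:
  assumes "\<And>i. i \<in> I \<Longrightarrow> assoc_algebra (A i)"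
  shows "assoc_algebra (prod_algebra I A)"
proof -
  let ?P = "prod_algebra I A"
  have R: "ring (A i)" if "i \<in> I" for i
    using assms[OF that] by (simp add: assoc_algebra_def)
  note G = abelian_group.axioms(1)[OF ring.is_abelian_group[OF R]]
  have r: "ring ?P"
  proof (rule ringI)
    show "abelian_group ?P"
    proof (rule abelian_groupI)
      fix x assume x: "x \<in> carrier ?P"
      then have "(\<lambda>i\<in>I. \<ominus>\<^bsub>A i\<^esub> x i) \<in> carrier ?P"
        by (auto simp: prod_algebra_def PiE_iff intro!: abelian_group.a_inv_closed
            ring.is_abelian_group R)
      moreover have "(\<lambda>i\<in>I. \<ominus>\<^bsub>A i\<^esub> x i) \<oplus>\<^bsub>?P\<^esub> x = \<zero>\<^bsub>?P\<^esub>"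
        using x by (auto simp: prod_algebra_def PiE_iff fun_eq_iff restrict_def
            intro!: abelian_group.l_neg ring.is_abelian_group R)
      ultimately show "\<exists>y\<in>carrier ?P. y \<oplus>\<^bsub>?P\<^esub> x = \<zero>\<^bsub>?P\<^esub>" by blast
    qed (auto simp: prod_algebra_def PiE_iff fun_eq_iff restrict_def extensional_def
        intro!: abelian_monoid.a_closed abelian_monoid.zero_closed abelian_monoid.a_assoc
          abelian_monoid.a_comm abelian_monoid.l_zero G)
    show "Group.monoid ?P"
      by (rule monoidI)
        (auto simp: prod_algebra_def PiE_iff fun_eq_iff restrict_def extensional_def
          intro!: monoid.m_closed monoid.one_closed monoid.m_assoc monoid.l_one monoid.r_one
            ring.is_monoid R)
  qed (auto simp: prod_algebra_def PiE_iff fun_eq_iff restrict_def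
      intro!: ring.ring_simprules(13) ring.ring_simprules(23) R)
  show ?thesis
    by (intro assoc_algebra.intro assoc_algebra_axioms.intro r)
      (use assms in \<open>auto simp: prod_algebra_def PiE_iff fun_eq_iff restrict_def extensional_def
        assoc_algebra_def assoc_algebra_axioms_def\<close>)
qed

lemma assoc_algebra_module_mat:
  "assoc_algebra (module_mat TYPE('k::field) n n)"
proof -
  have "ring (module_mat TYPE('k) n n)"
    by (rule ring_record_cong[OF ring_mat[of n "()"]]) (simp_all add: module_mat_def ring_mat_def)
  then show ?thesis
    by (intro assoc_algebra.intro assoc_algebra_axioms.intro)
      (auto simp: module_mat_def add_smult_distrib_right_mat add_smult_distrib_left_mat
        mult_smult_assoc_mat mult_smult_distrib)
qed

end

theory Submission
  imports Defs "HOL-Algebra.UnivPoly"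
begin

text \<open>
  Keep \<open>\<alpha>\<^sub>1\<close> fixed and let \<open>\<alpha>\<^sub>2 = t\<close> vary. Modulo the relations every element \<open>h\<close> of the free algebra on
  \<open>a, b, c\<close> reduces, simultaneously for all \<open>t\<close>, to a combination of the twelve words \<open>u\<close>, \<open>uc\<close> with
  \<open>u\<close> among \<open>1, a, b, ab, ba, aba\<close>, whose coefficients are polynomials in \<open>t\<close>. The algebra has three
  representations by \<open>2 \<times> 2\<close> matrices, each identifying two of the generators, and they separate the
  twelve words unless \<open>t = 3\<alpha>\<^sub>1\<close> or \<open>t = -\<alpha>\<^sub>1\<close>. If \<open>h\<close> comes from substituting into an identity of the
  matrix algebra, all representations kill it, so its coefficients vanish at all but two values of
  \<open>t\<close>; being polynomials over an infinite field, they vanish identically, and \<open>h\<close> lies in the ideal of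
  relations for every \<open>t\<close>.
\<close>

section \<open>Evaluation of noncommutative polynomials\<close>

lemma update_eq_plus_single:
  fixes f :: "'a \<Rightarrow>\<^sub>0 'b::comm_monoid_add"
  assumes "w \<notin> Poly_Mapping.keys f"
  shows "Poly_Mapping.update w k f = f + Poly_Mapping.single w k"
  using assms
  by (auto intro!: poly_mapping_eqI
      simp: lookup_update lookup_add lookup_single when_def in_keys_iff)

definition word_eval :: "('k::field, 'a) module \<Rightarrow> ('v \<Rightarrow> 'a) \<Rightarrow> 'v free_monoid \<Rightarrow> 'a" where
  "word_eval A x w = foldr (\<lambda>v y. x v \<otimes>\<^bsub>A\<^esub> y) (letters w) \<one>\<^bsub>A\<^esub>"

lemma nc_eval_word_eval:
  "nc_eval A x f =
     finsum A (\<lambda>w. Poly_Mapping.lookup f w \<odot>\<^bsub>A\<^esub> word_eval A x w) (Poly_Mapping.keys f)"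
  by (simp add: nc_eval_def word_eval_def)

context assoc_algebra
begin

lemma smult_0:
  assumes "x \<in> carrier A"
  shows "0 \<odot> x = \<zero>"
proof -
  have "0 \<odot> x \<oplus> 0 \<odot> x = 0 \<odot> x"
    using smult_add_left[OF assms, of 0 0] by simp
  then show ?thesis
    using smult_carrier[OF assms, of 0] by (metis add.r_cancel_one)
qed

lemma word_eval_closed:
  assumes "\<And>v. v \<in> set (letters w) \<Longrightarrow> x v \<in> carrier A"
  shows "word_eval A x w \<in> carrier A"
proof -
  have "foldr (\<lambda>v y. x v \<otimes> y) vs \<one> \<in> carrier A" if "\<And>v. v \<in> set vs \<Longrightarrow> x v \<in> carrier A" for vs
    using that by (induction vs) auto
  with assms show ?thesis by (simp add: word_eval_def)
qed

lemma word_eval_plus: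
  assumes "\<And>v. x v \<in> carrier A"
  shows "word_eval A x (u + w) = word_eval A x u \<otimes> word_eval A x w"
proof -
  have "foldr (\<lambda>v y. x v \<otimes> y) (us @ letters w) \<one> =
      foldr (\<lambda>v y. x v \<otimes> y) us \<one> \<otimes> word_eval A x w" for us
  proof (induction us)
    case Nil
    show ?case using word_eval_closed[of w x] assms by (simp add: word_eval_def)
  next
    case (Cons v us)
    have "foldr (\<lambda>v y. x v \<otimes> y) us \<one> \<in> carrier A"
      using word_eval_closed[of "Monomial us" x] assms by (simp add: word_eval_def)
    then show ?case
      using Cons word_eval_closed[of w x] assms by (simp add: m_assoc)
  qed
  then show ?thesis by (simp add: word_eval_def plus_free_monoid_def)
qed

text \<open>Substitutions for \<open>m\<close> variables are constrained on \<open>{1..m}\<close>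
  only; values outside the variable set may be arbitrary and even leave the carrier.\<close>

lemma nc_eval_cong:
  assumes "\<And>v. v \<in> V \<Longrightarrow> x v = y v" and y: "y \<in> V \<rightarrow> carrier A"
    and f: "f \<in> carrier (free_algebra V)"
  shows "nc_eval A x f = nc_eval A y f"
proof -
  have "foldr (\<lambda>v z. x v \<otimes> z) vs \<one> = foldr (\<lambda>v z. y v \<otimes> z) vs \<one>" if "set vs \<subseteq> V" for vs
    using that assms(1) by (induction vs) auto
  then have eq: "word_eval A x w = word_eval A y w" if "w \<in> Poly_Mapping.keys f" for w
    using that f by (auto simp: word_eval_def free_algebra_def)
  have "word_eval A y w \<in> carrier A" if "w \<in> Poly_Mapping.keys f" for w
    using that y f by (auto simp: free_algebra_def intro!: word_eval_closed)
  then show ?thesis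
    unfolding nc_eval_word_eval
    by (intro finsum_cong) (auto simp: simp_implies_def eq smult_carrier)
qed

context
  fixes x :: "'v \<Rightarrow> 'a"
  assumes x: "\<And>v. x v \<in> carrier A"
begin

text \<open>Terms may cancel in \<open>f + g\<close>, so supports differ; summing over a common
  finite set permits a termwise comparison.\<close>

lemma nc_eval_superset:
  assumes "finite S" "Poly_Mapping.keys f \<subseteq> S"
  shows "nc_eval A x f = (\<Oplus>w\<in>S. Poly_Mapping.lookup f w \<odot> word_eval A x w)"
  unfolding nc_eval_word_eval
  by (rule add.finprod_mono_neutral_cong_left)
    (use assms in \<open>auto simp: in_keys_iff smult_0 smult_carrier word_eval_closed x\<close>)

lemma nc_eval_closed: "nc_eval A x f \<in> carrier A"
  unfolding nc_eval_word_eval by (rule finsum_closed) (auto simp: smult_carrier word_eval_closed x)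

lemma nc_eval_add: "nc_eval A x (f + g) = nc_eval A x f \<oplus> nc_eval A x g"
proof -
  let ?S = "Poly_Mapping.keys f \<union> Poly_Mapping.keys g"
  have "nc_eval A x (f + g) =
      (\<Oplus>w\<in>?S. Poly_Mapping.lookup f w \<odot> word_eval A x w \<oplus> Poly_Mapping.lookup g w \<odot> word_eval A x w)"
    by (subst nc_eval_superset[of ?S])
      (use Poly_Mapping.keys_add[of f g] in
        \<open>auto simp: lookup_add smult_add_left word_eval_closed x\<close>)
  also have "\<dots> = nc_eval A x f \<oplus> nc_eval A x g"
    by (subst finsum_addf)
      (auto simp: nc_eval_superset[of ?S] smult_carrier word_eval_closed x)
  finally show ?thesis .
qed

lemma nc_eval_0: "nc_eval A x 0 = \<zero>"
  by (simp add: nc_eval_word_eval)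

lemma nc_eval_single: "nc_eval A x (Poly_Mapping.single w k) = k \<odot> word_eval A x w"
  by (subst nc_eval_superset[of "{w}"]) (auto simp: smult_carrier word_eval_closed x)

text \<open>Both sides are bilinear, so two inductions on the support reduce the claim to single
  words, where concatenation becomes multiplication and scalars can be pulled out.\<close>

lemma nc_eval_mult: "nc_eval A x (f * g) = nc_eval A x f \<otimes> nc_eval A x g"
proof -
  note closed = nc_eval_closed word_eval_closed x smult_carrier
  have single_single: "nc_eval A x (Poly_Mapping.single u k * Poly_Mapping.single w l) =
      nc_eval A x (Poly_Mapping.single u k) \<otimes> nc_eval A x (Poly_Mapping.single w l)" for u w k l
    by (simp add: mult_single nc_eval_single word_eval_plus closed smult_mult_left smult_mult_right
        mult.commute[of k] flip: smult_smult)
  have single: "nc_eval A x (Poly_Mapping.single u k * g) =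
      nc_eval A x (Poly_Mapping.single u k) \<otimes> nc_eval A x g" for u k
  proof (induction g rule: update_induct)
    case const
    then show ?case by (simp add: nc_eval_0 nc_eval_closed)
  next
    case (update g w l)
    then show ?case
      by (simp add: update_eq_plus_single distrib_left nc_eval_add nc_eval_closed r_distr single_single)
  qed
  show ?thesis
  proof (induction f rule: update_induct)
    case const
    then show ?case by (simp add: nc_eval_0 nc_eval_closed)
  next
    case (update f w l)
    then show ?case
      by (simp add: update_eq_plus_single distrib_right nc_eval_add nc_eval_closed l_distr single)
  qed
qed

lemma nc_eval_const: "nc_eval A x (nc_const k) = k \<odot> \<one>"
  by (simp add: nc_const_def nc_eval_single word_eval_def zero_free_monoid_def)

lemma nc_eval_var: "nc_eval A x (nc_var v) = x v"
  by (simp add: nc_var_def nc_eval_single word_eval_def smult_1 x)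

lemma nc_eval_1: "nc_eval A x 1 = \<one>"
  using nc_eval_const[of 1] by (simp add: nc_const_def smult_1)

end

end

section \<open>Algebra homomorphisms commute with evaluation\<close>

locale assoc_algebra_hom = ring_hom_ring A B h
  for A :: "('k::field, 'a) module" and B :: "('k, 'b) module" and h +
  assumes assoc_algebra_dom: "assoc_algebra A" and assoc_algebra_cod: "assoc_algebra B"
    and hom_smult: "x \<in> carrier A \<Longrightarrow> h (c \<odot>\<^bsub>A\<^esub> x) = c \<odot>\<^bsub>B\<^esub> h x"
begin

lemma hom_word_eval:
  assumes "\<And>v. v \<in> set (letters w) \<Longrightarrow> x v \<in> carrier A"
  shows "h (word_eval A x w) = word_eval B (\<lambda>v. h (x v)) w"
proof -
  have "h (word_eval A x (Monomial vs)) = word_eval B (\<lambda>v. h (x v)) (Monomial vs)"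
    if "\<And>v. v \<in> set vs \<Longrightarrow> x v \<in> carrier A" for vs
    using that
  proof (induction vs)
    case (Cons v vs)
    then show ?case
      using assoc_algebra.word_eval_closed[OF assoc_algebra_dom, of "Monomial vs" x]
      by (simp add: word_eval_def)
  qed (simp add: word_eval_def)
  from this[of "letters w"] assms show ?thesis by simp
qed

lemma hom_nc_eval:
  assumes x: "x \<in> V \<rightarrow> carrier A" and f: "f \<in> carrier (free_algebra V)"
  shows "h (nc_eval A x f) = nc_eval B (\<lambda>v. h (x v)) f"
proof -
  have closed: "word_eval A x w \<in> carrier A" "h (word_eval A x w) = word_eval B (\<lambda>v. h (x v)) w"
    if "w \<in> Poly_Mapping.keys f" for w
    using that x f assoc_algebra.word_eval_closed[OF assoc_algebra_dom, of w x] hom_word_eval[of w x]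
    by (auto simp: free_algebra_def)
  then have smult_closed: "c \<odot>\<^bsub>A\<^esub> word_eval A x w \<in> carrier A" if "w \<in> Poly_Mapping.keys f" for w c
    using that assoc_algebra.smult_carrier[OF assoc_algebra_dom] by blast
  have "h (nc_eval A x f) =
      finsum B (h \<circ> (\<lambda>w. Poly_Mapping.lookup f w \<odot>\<^bsub>A\<^esub> word_eval A x w)) (Poly_Mapping.keys f)"
    unfolding nc_eval_word_eval by (rule hom_finsum) (use smult_closed in auto)
  also have "\<dots> = nc_eval B (\<lambda>v. h (x v)) f"
    unfolding nc_eval_word_eval
    by (rule S.finsum_cong)
      (auto simp: hom_smult closed simp_implies_def
        intro!: assoc_algebra.smult_carrier[OF assoc_algebra_cod] simp flip: closed(2))
  finally show ?thesis .
qed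

end

section \<open>Normal forms modulo the relations\<close>

text \<open>The ideal whose quotient is \<open>D3 \<alpha>1 \<alpha>2\<close>. Membership in it,
  rather than equality of cosets, keeps the ordinary arithmetic of \<open>nc_poly\<close>
  available.\<close>

definition D3_ideal :: "'k::field \<Rightarrow> 'k \<Rightarrow> (D3_gen, 'k) nc_poly set" where
  "D3_ideal \<alpha>1 \<alpha>2 = genideal (free_algebra UNIV) (D3_relators \<alpha>1 \<alpha>2)"

lemma ideal_D3_ideal: "ideal (D3_ideal \<alpha>1 \<alpha>2) (free_algebra UNIV)"
proof -
  interpret F: assoc_algebra "free_algebra UNIV :: ('a, (D3_gen, 'a) nc_poly) module"
    by (rule assoc_algebra_free_algebra)
  show ?thesis
    unfolding D3_ideal_def by (rule F.genideal_ideal) (simp add: free_algebra_def)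
qed

lemma D3_relators_subset_D3_ideal: "D3_relators \<alpha>1 \<alpha>2 \<subseteq> D3_ideal \<alpha>1 \<alpha>2"
proof -
  interpret F: assoc_algebra "free_algebra UNIV :: ('a, (D3_gen, 'a) nc_poly) module"
    by (rule assoc_algebra_free_algebra)
  show ?thesis
    unfolding D3_ideal_def by (rule F.genideal_self) (simp add: free_algebra_def)
qed

lemma D3_ideal_0: "0 \<in> D3_ideal \<alpha>1 \<alpha>2"
  using additive_subgroup.zero_closed[OF ideal.axioms(1)[OF ideal_D3_ideal[of \<alpha>1 \<alpha>2]]]
  by (simp add: free_algebra_def)

lemma D3_ideal_add:
  assumes "f \<in> D3_ideal \<alpha>1 \<alpha>2" "g \<in> D3_ideal \<alpha>1 \<alpha>2"
  shows "f + g \<in> D3_ideal \<alpha>1 \<alpha>2"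
  using additive_subgroup.a_closed[OF ideal.axioms(1)[OF ideal_D3_ideal] assms]
  by (simp add: free_algebra_def)

lemma D3_ideal_mult_left:
  assumes "f \<in> D3_ideal \<alpha>1 \<alpha>2"
  shows "g * f \<in> D3_ideal \<alpha>1 \<alpha>2"
  using ideal.I_l_closed[OF ideal_D3_ideal assms, of g] by (simp add: free_algebra_def)

lemma D3_ideal_mult_right:
  assumes "f \<in> D3_ideal \<alpha>1 \<alpha>2"
  shows "f * g \<in> D3_ideal \<alpha>1 \<alpha>2"
  using ideal.I_r_closed[OF ideal_D3_ideal assms, of g] by (simp add: free_algebra_def)

lemma D3_ideal_diff:
  assumes "f \<in> D3_ideal \<alpha>1 \<alpha>2" "g \<in> D3_ideal \<alpha>1 \<alpha>2"
  shows "f - g \<in> D3_ideal \<alpha>1 \<alpha>2"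
  using D3_ideal_add[OF assms(1) D3_ideal_mult_left[OF assms(2), of "-1"]] by simp

lemmas D3_ideal_intros = D3_ideal_add D3_ideal_diff D3_ideal_mult_left D3_ideal_mult_right

lemma nc_const_add: "nc_const (c + d) = nc_const c + nc_const d"
  by (simp add: nc_const_def single_add)

lemma nc_const_minus: "nc_const (- c) = - nc_const c"
  by (simp add: nc_const_def single_uminus)

lemma nc_const_mult: "nc_const (c * d) = nc_const c * nc_const d"
  by (simp add: nc_const_def mult_single)

lemma nc_const_0: "nc_const 0 = 0"
  by (simp add: nc_const_def)

lemma nc_const_1: "nc_const 1 = 1"
  by (simp add: nc_const_def)

text \<open>Moving all constants to the front decides identities in the generators.\<close>

lemma nc_var_const: "nc_var v * nc_const k = nc_const k * nc_var v"
  by (rule nc_const_commute)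

lemma nc_var_const_left: "nc_var v * (nc_const k * f) = nc_const k * (nc_var v * f)"
  by (metis nc_const_commute mult.assoc)

lemmas nc_normalize = algebra_simps nc_var_const nc_var_const_left

section \<open>Normal words and the families that reduce to them\<close>

definition nc_word :: "'v list \<Rightarrow> ('v, 'k::field) nc_poly" where
  "nc_word vs = Poly_Mapping.single (Monomial vs) 1"

lemma nc_word_Nil [simp]: "nc_word [] = 1"
  by (simp add: nc_word_def flip: zero_free_monoid_def)

lemma nc_word_Cons [simp]: "nc_word (v # vs) = nc_var v * nc_word vs"
  by (simp add: nc_word_def nc_var_def mult_single plus_free_monoid_def)

lemma single_eq_nc_word: "Poly_Mapping.single w k = nc_const k * nc_word (letters w)"
  by (simp add: nc_word_def nc_const_def mult_single)

text \<open>The words without a factor \<open>aa\<close>, \<open>bb\<close>, \<open>cc\<close>,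
  \<open>ca\<close>, \<open>cb\<close> or \<open>bab\<close>. The first six are the reduced words of
  the symmetric group on three letters.\<close>

definition D3_words :: "D3_gen list set" where
  "D3_words =
     {[], [Gen_a], [Gen_b], [Gen_a, Gen_b], [Gen_b, Gen_a], [Gen_a, Gen_b, Gen_a],
      [Gen_c], [Gen_a, Gen_c], [Gen_b, Gen_c], [Gen_a, Gen_b, Gen_c], [Gen_b, Gen_a, Gen_c],
      [Gen_a, Gen_b, Gen_a, Gen_c]}"

definition normal_form :: "(D3_gen list \<Rightarrow> 'k::field) \<Rightarrow> (D3_gen, 'k) nc_poly" where
  "normal_form P = (\<Sum>vs\<in>D3_words. nc_const (P vs) * nc_word vs)"

text \<open>
  The parameter \<open>\<alpha>\<^sub>2\<close> becomes a variable, and the coefficients of a normal form are required to be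
  polynomials in it.
\<close>

definition reducible :: "'k::field \<Rightarrow> ('k \<Rightarrow> (D3_gen, 'k) nc_poly) \<Rightarrow> bool" where
  "reducible \<alpha>1 H \<longleftrightarrow> (\<exists>P. \<forall>t. H t - normal_form (\<lambda>vs. poly (P vs) t) \<in> D3_ideal \<alpha>1 t)"

lemma reducible_cong:
  assumes "reducible \<alpha>1 G" "\<And>t. H t - G t \<in> D3_ideal \<alpha>1 t"
  shows "reducible \<alpha>1 H"
proof -
  obtain P where P: "G t - normal_form (\<lambda>vs. poly (P vs) t) \<in> D3_ideal \<alpha>1 t" for t
    using assms(1) unfolding reducible_def by blast
  show ?thesis
    unfolding reducible_def
    using D3_ideal_add[OF assms(2) P] by (auto intro!: exI[of _ P])
qed

lemma reducible_add:
  assumes "reducible \<alpha>1 G" "reducible \<alpha>1 H"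
  shows "reducible \<alpha>1 (\<lambda>t. G t + H t)"
proof -
  obtain P where P: "G t - normal_form (\<lambda>vs. poly (P vs) t) \<in> D3_ideal \<alpha>1 t" for t
    using assms(1) unfolding reducible_def by blast
  obtain Q where Q: "H t - normal_form (\<lambda>vs. poly (Q vs) t) \<in> D3_ideal \<alpha>1 t" for t
    using assms(2) unfolding reducible_def by blast
  have "G t + H t - normal_form (\<lambda>vs. poly (P vs + Q vs) t) \<in> D3_ideal \<alpha>1 t" for t
    using D3_ideal_add[OF P Q, of t]
    by (simp add: normal_form_def nc_const_add distrib_right sum.distrib algebra_simps)
  then show ?thesis unfolding reducible_def by (intro exI[of _ "\<lambda>vs. P vs + Q vs"] allI)
qed

text \<open>Rewriting introduces the scalars \<alpha>1 and \<open>t\<close>; both are values of a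
  polynomial, a constant one and the indeterminate.\<close>

lemma reducible_scale:
  assumes "reducible \<alpha>1 H"
  shows "reducible \<alpha>1 (\<lambda>t. nc_const (poly p t) * H t)"
proof -
  obtain P where P: "H t - normal_form (\<lambda>vs. poly (P vs) t) \<in> D3_ideal \<alpha>1 t" for t
    using assms unfolding reducible_def by blast
  have "nc_const (poly p t) * H t - normal_form (\<lambda>vs. poly (p * P vs) t) \<in> D3_ideal \<alpha>1 t" for t
    using D3_ideal_mult_left[OF P, of "nc_const (poly p t)" t]
    by (simp add: normal_form_def nc_const_mult sum_distrib_left right_diff_distrib mult.assoc)
  then show ?thesis unfolding reducible_def by (intro exI[of _ "\<lambda>vs. p * P vs"] allI)
qed

lemma reducible_const: "reducible \<alpha>1 H \<Longrightarrow> reducible \<alpha>1 (\<lambda>t. nc_const k * H t)"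
  using reducible_scale[of \<alpha>1 H "[:k:]"] by simp

lemma reducible_param: "reducible \<alpha>1 H \<Longrightarrow> reducible \<alpha>1 (\<lambda>t. nc_const t * H t)"
  using reducible_scale[of \<alpha>1 H "[:0, 1:]"] by simp

lemma reducible_diff:
  assumes "reducible \<alpha>1 G" "reducible \<alpha>1 H"
  shows "reducible \<alpha>1 (\<lambda>t. G t - H t)"
  using reducible_add[OF assms(1) reducible_const[OF assms(2), where k = "- 1"]]
  by (simp add: nc_const_minus nc_const_1)

lemma reducible_0: "reducible \<alpha>1 (\<lambda>t. 0)"
  unfolding reducible_def
  by (rule exI[of _ "\<lambda>_. 0"]) (simp add: normal_form_def nc_const_0 D3_ideal_0)

lemma reducible_sum:
  assumes "\<And>i. i \<in> S \<Longrightarrow> reducible \<alpha>1 (H i)"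
  shows "reducible \<alpha>1 (\<lambda>t. \<Sum>i\<in>S. H i t)"
  using assms
  by (induction S rule: infinite_finite_induct) (auto intro: reducible_0 reducible_add)

lemma finite_D3_words: "finite D3_words"
  by (simp add: D3_words_def)

lemma reducible_nc_word:
  fixes \<alpha>1 :: "'k::field"
  assumes "vs \<in> D3_words"
  shows "reducible \<alpha>1 (\<lambda>t. nc_word vs)"
proof -
  have "normal_form (\<lambda>us. poly (if us = vs then 1 else 0) t) =
      (\<Sum>us\<in>D3_words. if us = vs then nc_word vs else 0)" for t :: 'k
    unfolding normal_form_def by (rule sum.cong) (auto simp: nc_const_0 nc_const_1)
  also have "\<dots> = nc_word vs"
    using assms by (simp add: finite_D3_words)
  finally show ?thesis
    unfolding reducible_def
    by (intro exI[of _ "\<lambda>us. if us = vs then 1 else 0"]) (simp add: D3_ideal_0)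
qed

section \<open>Rewriting rules derived from the relators\<close>

context
  fixes \<alpha>1 :: "'k::field"
begin

private abbreviation (input) "a \<equiv> nc_var Gen_a :: (D3_gen, 'k) nc_poly"
private abbreviation (input) "b \<equiv> nc_var Gen_b :: (D3_gen, 'k) nc_poly"
private abbreviation (input) "c \<equiv> nc_var Gen_c :: (D3_gen, 'k) nc_poly"
private abbreviation (input) "x \<equiv> nc_const \<alpha>1 :: (D3_gen, 'k) nc_poly"

lemma D3_ideal_relators:
  "a * a - x \<in> D3_ideal \<alpha>1 t" "b * b - x \<in> D3_ideal \<alpha>1 t" "c * c - x \<in> D3_ideal \<alpha>1 t"
  "c * a + b * c + a * b - nc_const t \<in> D3_ideal \<alpha>1 t"
  "c * b + b * a + a * c - nc_const t \<in> D3_ideal \<alpha>1 t"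
  using D3_relators_subset_D3_ideal[of \<alpha>1 t] by (simp_all add: D3_relators_def Let_def)

text \<open>The overlap \<open>caa\<close> of two relators: it reduces to \<open>\<alpha>\<^sub>1 c\<close> as well as by moving \<open>c\<close> to the right.\<close>

lemma D3_ideal_braid: "b * (a * b) - (a * (b * a) - nc_const t * a + nc_const t * b) \<in> D3_ideal \<alpha>1 t"
proof -
  let ?r = "c * a + b * c + a * b - nc_const t"
  have "b * (a * b) - (a * (b * a) - nc_const t * a + nc_const t * b) =
      b * ?r - ?r * a + c * (a * a - x) - (b * b - x) * c"
    by (simp add: nc_normalize)
  also have "\<dots> \<in> D3_ideal \<alpha>1 t"
    by (intro D3_ideal_intros D3_ideal_relators)
  finally show ?thesis .
qed

text \<open>The braid rule times \<open>a\<close> on the right, with \<open>a * a\<close> then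
  replaced by \<alpha>1.\<close>

lemma D3_ideal_b_aba:
  "b * (a * (b * a)) - (x * (a * b) - nc_const t * x + nc_const t * (b * a)) \<in> D3_ideal \<alpha>1 t"
proof -
  have "b * (a * (b * a)) - (x * (a * b) - nc_const t * x + nc_const t * (b * a)) =
      (b * (a * b) - (a * (b * a) - nc_const t * a + nc_const t * b)) * a + (a * b) * (a * a - x)
        - nc_const t * (a * a - x)"
    by (simp add: nc_normalize)
  also have "\<dots> \<in> D3_ideal \<alpha>1 t"
    by (intro D3_ideal_intros D3_ideal_relators D3_ideal_braid)
  finally show ?thesis .
qed

text \<open>Rewriting \<open>ca\<close> in \<open>cab\<close> and then \<open>cb\<close> produces
  the terms \<open>t b\<close> and \<open>\<alpha>1 a\<close> with both signs; only
  \<open>bac\<close> survives.\<close>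

lemma D3_ideal_c_ab: "c * (a * b) - b * (a * c) \<in> D3_ideal \<alpha>1 t"
proof -
  have "c * (a * b) - b * (a * c) =
      (c * a + b * c + a * b - nc_const t) * b - b * (c * b + b * a + a * c - nc_const t) + (b * b - x) * a
        - a * (b * b - x)"
    by (simp add: nc_normalize)
  also have "\<dots> \<in> D3_ideal \<alpha>1 t"
    by (intro D3_ideal_intros D3_ideal_relators)
  finally show ?thesis .
qed

text \<open>Mirror image of the preceding rule: exchanging \<open>a\<close> and \<open>b\<close>
  exchanges the two mixed relators.\<close>

lemma D3_ideal_c_ba: "c * (b * a) - a * (b * c) \<in> D3_ideal \<alpha>1 t"
proof -
  have "c * (b * a) - a * (b * c) =
      (c * b + b * a + a * c - nc_const t) * a - a * (c * a + b * c + a * b - nc_const t) + (a * a - x) * b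
        - b * (a * a - x)"
    by (simp add: nc_normalize)
  also have "\<dots> \<in> D3_ideal \<alpha>1 t"
    by (intro D3_ideal_intros D3_ideal_relators)
  finally show ?thesis .
qed

text \<open>First \<open>caba\<close> becomes \<open>baca\<close>, then \<open>ca\<close> is
  rewritten; of the new terms, \<open>baab\<close> reduces to the square of \<alpha>1 and
  \<open>babc\<close> by the braid rule.\<close>

lemma D3_ideal_c_aba:
  "c * (a * (b * a)) - (nc_const t * (b * a) - x * x
      - (a * (b * a) - nc_const t * a + nc_const t * b) * c) \<in> D3_ideal \<alpha>1 t"
proof -
  have "c * (a * (b * a)) - (nc_const t * (b * a) - x * x
      - (a * (b * a) - nc_const t * a + nc_const t * b) * c) =
      (c * (a * b) - b * (a * c)) * a + (b * a) * (c * a + b * c + a * b - nc_const t)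
        - (b * (a * b) - (a * (b * a) - nc_const t * a + nc_const t * b)) * c
        - b * (a * a - x) * b - x * (b * b - x)"
    by (simp add: nc_normalize)
  also have "\<dots> \<in> D3_ideal \<alpha>1 t"
    by (intro D3_ideal_intros D3_ideal_relators D3_ideal_braid D3_ideal_c_ab)
  finally show ?thesis .
qed

text \<open>
  The normal words come in pairs \<open>u\<close>, \<open>uc\<close>; stability lets one rewrite a product with \<open>u\<close> and append
  the final \<open>c\<close> afterwards.
\<close>

private definition "c_stable H \<longleftrightarrow> reducible \<alpha>1 H \<and> reducible \<alpha>1 (\<lambda>t. H t * c)"

private lemma c_stable_add: "c_stable G \<Longrightarrow> c_stable H \<Longrightarrow> c_stable (\<lambda>t. G t + H t)"
  by (simp add: c_stable_def distrib_right reducible_add)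

private lemma c_stable_diff: "c_stable G \<Longrightarrow> c_stable H \<Longrightarrow> c_stable (\<lambda>t. G t - H t)"
  by (simp add: c_stable_def left_diff_distrib reducible_diff)

private lemma c_stable_const: "c_stable H \<Longrightarrow> c_stable (\<lambda>t. nc_const k * H t)"
  by (simp add: c_stable_def mult.assoc reducible_const)

private lemma c_stable_param: "c_stable H \<Longrightarrow> c_stable (\<lambda>t. nc_const t * H t)"
  by (simp add: c_stable_def mult.assoc reducible_param)

private lemma c_stable_cong:
  assumes "c_stable G" "\<And>t. H t - G t \<in> D3_ideal \<alpha>1 t"
  shows "c_stable H"
proof -
  have "H t * c - G t * c \<in> D3_ideal \<alpha>1 t" for t
    using D3_ideal_mult_right[OF assms(2)[of t], of c] by (simp add: left_diff_distrib)
  with assms show ?thesis unfolding c_stable_def by (blast intro: reducible_cong)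
qed

private lemma c_stable_words:
  "c_stable (\<lambda>t. 1)" "c_stable (\<lambda>t. a)" "c_stable (\<lambda>t. b)" "c_stable (\<lambda>t. a * b)" "c_stable (\<lambda>t. b * a)"
  "c_stable (\<lambda>t. a * (b * a))"
  using reducible_nc_word[of "[]" \<alpha>1] reducible_nc_word[of "[Gen_a]" \<alpha>1]
    reducible_nc_word[of "[Gen_b]" \<alpha>1] reducible_nc_word[of "[Gen_a, Gen_b]" \<alpha>1]
    reducible_nc_word[of "[Gen_b, Gen_a]" \<alpha>1] reducible_nc_word[of "[Gen_a, Gen_b, Gen_a]" \<alpha>1]
    reducible_nc_word[of "[Gen_c]" \<alpha>1] reducible_nc_word[of "[Gen_a, Gen_c]" \<alpha>1]
    reducible_nc_word[of "[Gen_b, Gen_c]" \<alpha>1] reducible_nc_word[of "[Gen_a, Gen_b, Gen_c]" \<alpha>1]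
    reducible_nc_word[of "[Gen_b, Gen_a, Gen_c]" \<alpha>1]
    reducible_nc_word[of "[Gen_a, Gen_b, Gen_a, Gen_c]" \<alpha>1]
  by (simp_all add: D3_words_def c_stable_def mult.assoc)

private lemma c_stable_const_1: "c_stable (\<lambda>t. nc_const k)" "c_stable (\<lambda>t. nc_const t)"
  using c_stable_const[OF c_stable_words(1)] c_stable_param[OF c_stable_words(1)] by simp_all

text \<open>A second \<open>c\<close> turns \<open>H t * c\<close> back into \<open>H t\<close> up
  to the factor \<alpha>1, so nothing beyond the pair has to be checked.\<close>

private lemma c_stable_mult_c:
  assumes "c_stable H"
  shows "c_stable (\<lambda>t. H t * c)"
proof -
  have "reducible \<alpha>1 (\<lambda>t. x * H t)"
    using assms by (simp add: c_stable_def reducible_const)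
  moreover have "H t * c * c - x * H t \<in> D3_ideal \<alpha>1 t" for t
    using D3_ideal_mult_left[OF D3_ideal_relators(3)[of t], of "H t"]
    by (simp add: right_diff_distrib mult.assoc nc_const_commute)
  ultimately have "reducible \<alpha>1 (\<lambda>t. H t * c * c)"
    by (rule reducible_cong)
  with assms show ?thesis by (simp add: c_stable_def)
qed

private lemmas c_stable_intros =
  c_stable_words c_stable_const_1 c_stable_add c_stable_diff c_stable_const c_stable_param c_stable_mult_c

text \<open>The products of \<open>a\<close> with one of the six words \<open>u\<close> that are not
  again among these six; the next two lemmas do the same for \<open>b\<close> and \<open>c\<close>.
  Products with \<open>uc\<close> follow by stability.\<close>

private lemma c_stable_a:
  "c_stable (\<lambda>t. a * a)" "c_stable (\<lambda>t. a * (a * b))" "c_stable (\<lambda>t. a * (a * (b * a)))"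
proof -
  show aa: "c_stable (\<lambda>t. a * a)"
    by (rule c_stable_cong[OF _ D3_ideal_relators(1)]) (intro c_stable_intros)
  have *: "a * (a * f) - x * f \<in> D3_ideal \<alpha>1 t" for f t
    using D3_ideal_mult_right[OF D3_ideal_relators(1)[of t], of f]
    by (simp add: left_diff_distrib mult.assoc)
  show "c_stable (\<lambda>t. a * (a * b))" "c_stable (\<lambda>t. a * (a * (b * a)))"
    by (rule c_stable_cong[OF _ *], intro c_stable_intros)+
qed

private lemma c_stable_b:
  "c_stable (\<lambda>t. b * b)" "c_stable (\<lambda>t. b * (a * b))" "c_stable (\<lambda>t. b * (b * a))"
  "c_stable (\<lambda>t. b * (a * (b * a)))"
proof -
  have *: "b * (b * f) - x * f \<in> D3_ideal \<alpha>1 t" for f t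
    using D3_ideal_mult_right[OF D3_ideal_relators(2)[of t], of f]
    by (simp add: left_diff_distrib mult.assoc)
  show "c_stable (\<lambda>t. b * b)"
    by (rule c_stable_cong[OF _ D3_ideal_relators(2)]) (intro c_stable_intros)
  show "c_stable (\<lambda>t. b * (a * b))"
    by (rule c_stable_cong[OF _ D3_ideal_braid]) (intro c_stable_intros)
  show "c_stable (\<lambda>t. b * (b * a))"
    by (rule c_stable_cong[OF _ *]) (intro c_stable_intros)
  show "c_stable (\<lambda>t. b * (a * (b * a)))"
    by (rule c_stable_cong[OF _ D3_ideal_b_aba]) (intro c_stable_intros)
qed

private lemma c_stable_c:
  "c_stable (\<lambda>t. c)" "c_stable (\<lambda>t. c * a)" "c_stable (\<lambda>t. c * b)" "c_stable (\<lambda>t. c * (a * b))"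
  "c_stable (\<lambda>t. c * (b * a))" "c_stable (\<lambda>t. c * (a * (b * a)))"
proof -
  show "c_stable (\<lambda>t. c)"
    using c_stable_mult_c[OF c_stable_words(1)] by simp
  have "c * a - (nc_const t - a * b - b * c) \<in> D3_ideal \<alpha>1 t" for t
    using D3_ideal_relators(4)[of t] by (simp add: algebra_simps)
  then show "c_stable (\<lambda>t. c * a)"
    by (rule c_stable_cong[rotated]) (intro c_stable_intros)
  have "c * b - (nc_const t - b * a - a * c) \<in> D3_ideal \<alpha>1 t" for t
    using D3_ideal_relators(5)[of t] by (simp add: algebra_simps)
  then show "c_stable (\<lambda>t. c * b)"
    by (rule c_stable_cong[rotated]) (intro c_stable_intros)
  \<comment> \<open>Bracketed so that \<open>c_stable_mult_c\<close> applies; reassociated, these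
    are the results of moving \<open>c\<close> past \<open>ab\<close> and \<open>ba\<close>.\<close>
  have "c_stable (\<lambda>t. (b * a) * c)" "c_stable (\<lambda>t. (a * b) * c)"
    by (intro c_stable_intros)+
  then have "c_stable (\<lambda>t. b * (a * c))" "c_stable (\<lambda>t. a * (b * c))"
    by (simp_all add: mult.assoc)
  then show "c_stable (\<lambda>t. c * (a * b))" "c_stable (\<lambda>t. c * (b * a))"
    by (blast intro: c_stable_cong D3_ideal_c_ab D3_ideal_c_ba)+
  show "c_stable (\<lambda>t. c * (a * (b * a)))"
    by (rule c_stable_cong[OF _ D3_ideal_c_aba]) (intro c_stable_intros)
qed

private lemma reducible_var_nc_word:
  assumes "vs \<in> D3_words"
  shows "reducible \<alpha>1 (\<lambda>t. nc_var v * nc_word vs)"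
  using assms c_stable_words c_stable_a c_stable_b c_stable_c
  by (cases v) (auto simp: D3_words_def c_stable_def mult.assoc)

text \<open>Expanding \<open>H t\<close> leaves products of a generator with a normal word, with
  central coefficients that are polynomial in \<open>t\<close>.\<close>

lemma reducible_var_mult:
  assumes "reducible \<alpha>1 H"
  shows "reducible \<alpha>1 (\<lambda>t. nc_var v * H t)"
proof -
  obtain P where P: "H t - normal_form (\<lambda>vs. poly (P vs) t) \<in> D3_ideal \<alpha>1 t" for t
    using assms unfolding reducible_def by blast
  have "reducible \<alpha>1 (\<lambda>t. \<Sum>vs\<in>D3_words. nc_const (poly (P vs) t) * (nc_var v * nc_word vs))"
    by (intro reducible_sum reducible_scale reducible_var_nc_word)
  moreover have "nc_var v * H t -
      (\<Sum>vs\<in>D3_words. nc_const (poly (P vs) t) * (nc_var v * nc_word vs)) \<in> D3_ideal \<alpha>1 t" for t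
    using D3_ideal_mult_left[OF P, of "nc_var v" t]
    by (simp add: normal_form_def right_diff_distrib sum_distrib_left nc_var_const_left)
  ultimately show ?thesis by (rule reducible_cong)
qed

end

text \<open>Every word arises from the empty one by left multiplication with generators; linearity
  does the rest. Here \<open>h\<close> is independent of \<open>t\<close>, and only its normal form
  varies.\<close>

lemma reducible_nc_poly: "reducible \<alpha>1 (\<lambda>t. h)"
proof (induction h rule: update_induct)
  case const
  show ?case by (rule reducible_0)
next
  case (update h w k)
  have "reducible \<alpha>1 (\<lambda>t. nc_word vs)" for vs
  proof (induction vs)
    case Nil
    show ?case by (rule reducible_nc_word) (simp add: D3_words_def)
  qed (simp add: reducible_var_mult)
  then have "reducible \<alpha>1 (\<lambda>t. h + nc_const k * nc_word (letters w))"
    by (intro reducible_add reducible_const update)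
  moreover have "Poly_Mapping.update w k h = h + Poly_Mapping.single w k"
    by (rule update_eq_plus_single[OF update(1)])
  ultimately show ?case by (simp add: single_eq_nc_word)
qed

section \<open>Two-dimensional representations\<close>

text \<open>The universal property of the free algebra: any images of the generators extend to a
  homomorphism.\<close>

lemma (in assoc_algebra) assoc_algebra_hom_nc_eval:
  fixes x :: "'v \<Rightarrow> 'a"
  assumes "\<And>v. x v \<in> carrier A"
  shows "assoc_algebra_hom (free_algebra UNIV) A (nc_eval A x)"
proof -
  interpret F: assoc_algebra "free_algebra UNIV :: ('k, ('v, 'k) nc_poly) module"
    by (rule assoc_algebra_free_algebra)
  note simps = nc_eval_closed nc_eval_add nc_eval_mult nc_eval_1 nc_eval_const
  have "nc_eval A x \<in> Ring.ring_hom (free_algebra UNIV) A"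
    by (rule ring_hom_memI) (simp_all add: free_algebra_def simps assms)
  then have "ring_hom_ring (free_algebra UNIV) A (nc_eval A x)"
    by (rule ring_hom_ringI2[OF F.ring_axioms ring_axioms])
  then show ?thesis
    by (intro assoc_algebra_hom.intro assoc_algebra_hom_axioms.intro F.assoc_algebra_axioms
        assoc_algebra_axioms)
      (simp_all add: free_algebra_def simps assms smult_mult_left)
qed

text \<open>The kernel of evaluation is an ideal, so it suffices that it contains the
  relators.\<close>

lemma (in assoc_algebra) nc_eval_D3_ideal:
  assumes x: "\<And>v. x v \<in> carrier A"
    and "\<And>f. f \<in> D3_relators \<alpha>1 \<alpha>2 \<Longrightarrow> nc_eval A x f = \<zero>"
    and "f \<in> D3_ideal \<alpha>1 \<alpha>2"
  shows "nc_eval A x f = \<zero>"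
proof -
  interpret h: assoc_algebra_hom "free_algebra UNIV" A "nc_eval A x"
    by (rule assoc_algebra_hom_nc_eval[OF x])
  have "D3_ideal \<alpha>1 \<alpha>2 \<subseteq> a_kernel (free_algebra UNIV) A (nc_eval A x)"
    unfolding D3_ideal_def
  proof (rule h.R.genideal_minimal[OF h.kernel_is_ideal], rule subsetI)
    fix f assume "f \<in> D3_relators \<alpha>1 \<alpha>2"
    then have "nc_eval A x f = \<zero>" by (rule assms(2))
    then show "f \<in> a_kernel (free_algebra UNIV) A (nc_eval A x)"
      unfolding a_kernel_def' by (simp add: free_algebra_def)
  qed
  then show ?thesis using assms(3) unfolding a_kernel_def' by blast
qed

lemma (in assoc_algebra) nc_eval_eq_0_cong:
  fixes f g :: "('v, 'k) nc_poly"
  assumes x: "\<And>v. x v \<in> carrier A"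
    and "nc_eval A x (f - g) = \<zero>" "nc_eval A x f = \<zero>"
  shows "nc_eval A x g = \<zero>"
proof -
  have "nc_eval A x f = nc_eval A x (f - g) \<oplus> nc_eval A x g"
    using nc_eval_add[where x = x and f = "f - g" and g = g, OF x] by simp
  with assms show ?thesis by (simp add: nc_eval_closed[where x = x, OF x])
qed

lemma (in assoc_algebra) nc_eval_diff_eq_0:
  fixes f g :: "('v, 'k) nc_poly"
  assumes x: "\<And>v. x v \<in> carrier A" and "nc_eval A x f = nc_eval A x g"
  shows "nc_eval A x (f - g) = \<zero>"
proof -
  have "nc_eval A x f = nc_eval A x (f - g) \<oplus> nc_eval A x g"
    using nc_eval_add[where x = x and f = "f - g" and g = g, OF x] by simp
  with assms show ?thesis
    by (metis nc_eval_closed[where x = x, OF x] add.r_cancel_one)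
qed

section \<open>Entrywise arithmetic of two-by-two matrices\<close>

definition mat22 :: "'k \<Rightarrow> 'k \<Rightarrow> 'k \<Rightarrow> 'k \<Rightarrow> 'k::field mat" where
  "mat22 a b c d = mat 2 2 (\<lambda>(i, j).
     if i = 0 then (if j = 0 then a else b) else (if j = 0 then c else d))"

lemma mat22_carrier: "mat22 a b c d \<in> carrier_mat 2 2"
  by (simp add: mat22_def)

lemma mat22_eq_iff:
  "mat22 a b c d = mat22 a' b' c' d' \<longleftrightarrow> a = a' \<and> b = b' \<and> c = c' \<and> d = d'"
  by (auto simp: mat22_def mat_eq_iff less_Suc_eq numeral_2_eq_2)

lemma mat22_add: "mat22 a b c d + mat22 a' b' c' d' = mat22 (a + a') (b + b') (c + c') (d + d')"
  by (rule eq_matI) (auto simp: mat22_def)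

lemma mat22_smult: "k \<cdot>\<^sub>m mat22 a b c d = mat22 (k * a) (k * b) (k * c) (k * d)"
  by (rule eq_matI) (auto simp: mat22_def)

lemma mat22_mult:
  "mat22 a b c d * mat22 a' b' c' d' =
     mat22 (a * a' + b * c') (a * b' + b * d') (c * a' + d * c') (c * b' + d * d')"
  by (rule eq_matI) (auto simp: mat22_def scalar_prod_def less_Suc_eq numeral_2_eq_2)

lemma mat22_one: "1\<^sub>m 2 = mat22 1 0 0 1"
  by (rule eq_matI) (auto simp: mat22_def less_Suc_eq numeral_2_eq_2)

lemma mat22_zero: "0\<^sub>m 2 2 = mat22 0 0 0 0"
  by (rule eq_matI) (auto simp: mat22_def)

lemmas mat22_simps = mat22_add mat22_smult mat22_mult mat22_one mat22_zero module_mat_simps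

text \<open>
  The matrices \<open>p\<close> and \<open>q\<close> satisfy \<open>p\<^sup>2 = q\<^sup>2 = r\<^sup>2\<close> and \<open>pq + qp = \<beta>\<close>. Setting each of \<open>a, b, c\<close> to
  \<open>p\<close> or \<open>q\<close>, not all to the same one, therefore satisfies the relations with \<open>\<alpha>\<^sub>1 = r\<^sup>2\<close> and
  \<open>\<alpha>\<^sub>2 = r\<^sup>2 + \<beta>\<close>.
\<close>

context
  fixes r \<beta> :: "'k::field"
begin

private abbreviation (input) "M \<equiv> module_mat TYPE('k) 2 2"
private abbreviation (input) "s \<equiv> r * r"
private abbreviation (input) "p \<equiv> mat22 0 1 s 0"
private abbreviation (input) "q \<equiv> mat22 r 0 \<beta> (- r)"

text \<open>This is \<open>c1 + c2 p + c3 q + c4 pq\<close>.\<close>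

private definition "clifford c1 c2 c3 c4 =
  mat22 (c1 + c3 * r + c4 * \<beta>) (c2 - r * c4) (c2 * s + c3 * \<beta> + c4 * s * r) (c1 - c3 * r)"

text \<open>Eliminating \<open>c1\<close> and \<open>c2\<close> leaves
  \<open>2 r c3 + \<beta> c4 = 0\<close> and \<open>\<beta> c3 + 2 s r c4 = 0\<close>, a system
  whose determinant is \<open>\<beta> * \<beta> - 4 * s * s\<close> up to sign.\<close>

private lemma clifford_eq_0:
  assumes ne: "\<beta> * \<beta> \<noteq> 4 * s * s" and 0: "clifford c1 c2 c3 c4 = 0\<^sub>m 2 2"
  shows "c1 = 0 \<and> c2 = 0 \<and> c3 = 0 \<and> c4 = 0"
proof -
  have eqs: "c1 + c3 * r + c4 * \<beta> = 0" "c2 - r * c4 = 0" "c2 * s + c3 * \<beta> + c4 * s * r = 0"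
    "c1 - c3 * r = 0"
    using 0 unfolding clifford_def mat22_zero mat22_eq_iff by blast+
  \<comment> \<open>Cramer's rule for this system; \<open>c4\<close> is treated likewise.\<close>
  have "(\<beta> * \<beta> - 4 * s * s) * c3 =
      \<beta> * ((c2 * s + c3 * \<beta> + c4 * s * r) - s * (c2 - r * c4))
      - 2 * s * r * ((c1 + c3 * r + c4 * \<beta>) - (c1 - c3 * r))"
    by (simp add: algebra_simps)
  then have c3: "c3 = 0" unfolding eqs using ne by simp
  have "(\<beta> * \<beta> - 4 * s * s) * c4 =
      \<beta> * ((c1 + c3 * r + c4 * \<beta>) - (c1 - c3 * r))
      - 2 * r * ((c2 * s + c3 * \<beta> + c4 * s * r) - s * (c2 - r * c4))"
    by (simp add: algebra_simps)
  then have c4: "c4 = 0" unfolding eqs using ne by simp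
  show ?thesis using eqs c3 c4 by simp
qed

text \<open>The image of a normal form when \<open>a, b, c\<close> go to \<open>g1, g2, g3\<close>:
  \<open>p1\<close> to \<open>p6\<close> are the coefficients of
  \<open>u = 1, a, b, ab, ba, aba\<close>, and \<open>q1\<close> to \<open>q6\<close> those of
  \<open>uc\<close>. The nesting matches the unfolded sum over \<open>D3_words\<close>.\<close>

private definition "generic g1 g2 g3 p1 p2 p3 p4 p5 p6 q1 q2 q3 q4 q5 q6 =
  p1 \<cdot>\<^sub>m 1\<^sub>m 2 + (p2 \<cdot>\<^sub>m g1 + (p3 \<cdot>\<^sub>m g2 + (p4 \<cdot>\<^sub>m (g1 * g2) + (p5 \<cdot>\<^sub>m (g2 * g1)
  + (p6 \<cdot>\<^sub>m (g1 * (g2 * g1)) + (q1 \<cdot>\<^sub>m g3 + (q2 \<cdot>\<^sub>m (g1 * g3) + (q3 \<cdot>\<^sub>m (g2 * g3)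
  + (q4 \<cdot>\<^sub>m (g1 * (g2 * g3)) + (q5 \<cdot>\<^sub>m (g2 * (g1 * g3))
  + q6 \<cdot>\<^sub>m (g1 * (g2 * (g1 * g3)))))))))))))"

text \<open>Each \<open>u\<close> collapses to a power of \<open>p\<close>, and the final
  \<open>c\<close> contributes \<open>q\<close>.\<close>

private lemma generic_ppq:
  "generic p p q p1 p2 p3 p4 p5 p6 q1 q2 q3 q4 q5 q6 =
     clifford (p1 + s * (p4 + p5)) (p2 + p3 + s * p6) (q1 + s * (q4 + q5)) (q2 + q3 + s * q6)"
  unfolding generic_def clifford_def mat22_simps mat22_eq_iff
  by (intro conjI; simp add: algebra_simps)

text \<open>By \<open>qp = \<beta> - pq\<close> and \<open>pqp = \<beta> p - s q\<close>, the words
  \<open>u\<close> collapse to \<open>1, p, q, pq\<close>; the half belonging to \<open>uc\<close>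
  is then multiplied by \<open>q\<close> on the right.\<close>

private lemma generic_pqq:
  "generic p q q p1 p2 p3 p4 p5 p6 q1 q2 q3 q4 q5 q6 =
     clifford (p1 + \<beta> * p5 + s * (q3 - s * q6)) (p2 + \<beta> * p6 + s * (q4 - q5))
       (p3 - s * p6 + q1 + \<beta> * q5) (p4 - p5 + q2 + \<beta> * q6)"
  unfolding generic_def clifford_def mat22_simps mat22_eq_iff
  by (intro conjI; simp add: algebra_simps)

text \<open>As before, with the second half multiplied by \<open>p\<close> instead. Its coefficients
  \<open>q1 + \<beta> q5\<close>, \<open>q2 + \<beta> q6\<close>, \<open>q3 - s q6\<close>,
  \<open>q4 - q5\<close> are kept as blocks.\<close>

private lemma generic_pqp:
  "generic p q p p1 p2 p3 p4 p5 p6 q1 q2 q3 q4 q5 q6 =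
     clifford (p1 + \<beta> * p5 + s * (q2 + \<beta> * q6) + \<beta> * (q3 - s * q6))
       (p2 + \<beta> * p6 + q1 + \<beta> * q5 + \<beta> * (q4 - q5))
       (p3 - s * p6 - s * (q4 - q5)) (p4 - p5 - (q3 - s * q6))"
  unfolding generic_def clifford_def mat22_simps mat22_eq_iff
  by (intro conjI; simp add: algebra_simps)

text \<open>Independence of \<open>1, p, q, pq\<close> turns the three matrix equations into twelve
  scalar equations for the twelve coefficients.\<close>

private lemma generic_eq_0:
  assumes ne: "\<beta> * \<beta> \<noteq> 4 * s * s"
    and "generic p p q p1 p2 p3 p4 p5 p6 q1 q2 q3 q4 q5 q6 = 0\<^sub>m 2 2"
    and "generic p q q p1 p2 p3 p4 p5 p6 q1 q2 q3 q4 q5 q6 = 0\<^sub>m 2 2"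
    and "generic p q p p1 p2 p3 p4 p5 p6 q1 q2 q3 q4 q5 q6 = 0\<^sub>m 2 2"
  shows "p1 = 0 \<and> p2 = 0 \<and> p3 = 0 \<and> p4 = 0 \<and> p5 = 0 \<and> p6 = 0 \<and>
    q1 = 0 \<and> q2 = 0 \<and> q3 = 0 \<and> q4 = 0 \<and> q5 = 0 \<and> q6 = 0"
proof -
  have ppq: "p1 + s * (p4 + p5) = 0" "p2 + p3 + s * p6 = 0" "q1 + s * (q4 + q5) = 0"
    "q2 + q3 + s * q6 = 0"
    using clifford_eq_0[OF ne assms(2)[unfolded generic_ppq]] by blast+
  have pqq: "p1 + \<beta> * p5 + s * (q3 - s * q6) = 0" "p2 + \<beta> * p6 + s * (q4 - q5) = 0"
    "p3 - s * p6 + q1 + \<beta> * q5 = 0" "p4 - p5 + q2 + \<beta> * q6 = 0"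
    using clifford_eq_0[OF ne assms(3)[unfolded generic_pqq]] by blast+
  have pqp: "p1 + \<beta> * p5 + s * (q2 + \<beta> * q6) + \<beta> * (q3 - s * q6) = 0"
    "p2 + \<beta> * p6 + q1 + \<beta> * q5 + \<beta> * (q4 - q5) = 0"
    "p3 - s * p6 - s * (q4 - q5) = 0" "p4 - p5 - (q3 - s * q6) = 0"
    using clifford_eq_0[OF ne assms(4)[unfolded generic_pqp]] by blast+
  \<comment> \<open>The factor \<open>\<beta> - 2 * s\<close> divides
    \<open>\<beta> * \<beta> - 4 * s * s\<close>, which is nonzero.\<close>
  have cancel: "u = 0" if "(\<beta> - 2 * s) * u = v" "v = 0" for u v
  proof -
    have "\<beta> - 2 * s \<noteq> 0"
    proof
      assume "\<beta> - 2 * s = 0"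
      then have "\<beta> = 2 * s" by simp
      with ne show False by (simp add: algebra_simps)
    qed
    with that show ?thesis by simp
  qed
  \<comment> \<open>Six combinations of the equations each isolate one unknown times
    \<open>\<beta> - 2 * s\<close>; the other six unknowns can then be read off.\<close>
  have "(\<beta> - 2 * s) * q6 = (p4 - p5 + q2 + \<beta> * q6) - (p4 - p5 - (q3 - s * q6))
      - (q2 + q3 + s * q6)"
    by (simp add: algebra_simps)
  then have q6: "q6 = 0" by (rule cancel) (simp only: ppq pqq pqp add_0 diff_0_right mult_zero_right)
  have "(\<beta> - 2 * s) * p5 = (p1 + \<beta> * p5 + s * (q3 - s * q6)) - (p1 + s * (p4 + p5))
      + s * (p4 - p5 - (q3 - s * q6))"
    by (simp add: algebra_simps)
  then have p5: "p5 = 0" by (rule cancel) (simp only: ppq pqq pqp add_0 diff_0_right mult_zero_right)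
  have "(\<beta> - 2 * s) * q3 = (p1 + \<beta> * p5 + s * (q2 + \<beta> * q6) + \<beta> * (q3 - s * q6))
      - (p1 + \<beta> * p5 + s * (q3 - s * q6)) - s * (q2 + q3 + s * q6)"
    by (simp add: algebra_simps)
  then have q3: "q3 = 0" by (rule cancel) (simp only: ppq pqq pqp add_0 diff_0_right mult_zero_right)
  have "(\<beta> - 2 * s) * q4 = (p2 + \<beta> * p6 + q1 + \<beta> * q5 + \<beta> * (q4 - q5))
      - (p2 + \<beta> * p6 + s * (q4 - q5)) - (q1 + s * (q4 + q5))"
    by (simp add: algebra_simps)
  then have q4: "q4 = 0" by (rule cancel) (simp only: ppq pqq pqp add_0 diff_0_right mult_zero_right)
  have "(\<beta> - 2 * s) * p6 = (p2 + \<beta> * p6 + s * (q4 - q5)) + (p3 - s * p6 - s * (q4 - q5))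
      - (p2 + p3 + s * p6)"
    by (simp add: algebra_simps)
  then have p6: "p6 = 0" by (rule cancel) (simp only: ppq pqq pqp add_0 diff_0_right mult_zero_right)
  have "(\<beta> - 2 * s) * q5 = (p3 - s * p6 + q1 + \<beta> * q5) - (p3 - s * p6 - s * (q4 - q5))
      - (q1 + s * (q4 + q5))"
    by (simp add: algebra_simps)
  then have q5: "q5 = 0" by (rule cancel) (simp only: ppq pqq pqp add_0 diff_0_right mult_zero_right)
  show ?thesis
    using ppq pqq(2) pqp(3,4) q6 p5 q3 q4 p6 q5 by simp
qed

section \<open>Normal forms and relators under the three representations\<close>

private abbreviation (input) "rep g1 g2 g3 \<equiv> case_D3_gen g1 g2 g3 :: D3_gen \<Rightarrow> 'k mat"

private lemma nc_eval_rep_normal_form: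
  assumes g: "g1 \<in> carrier_mat 2 2" "g2 \<in> carrier_mat 2 2" "g3 \<in> carrier_mat 2 2"
  shows "nc_eval M (rep g1 g2 g3) (normal_form P) =
    generic g1 g2 g3 (P []) (P [Gen_a]) (P [Gen_b]) (P [Gen_a, Gen_b]) (P [Gen_b, Gen_a])
      (P [Gen_a, Gen_b, Gen_a]) (P [Gen_c]) (P [Gen_a, Gen_c]) (P [Gen_b, Gen_c])
      (P [Gen_a, Gen_b, Gen_c]) (P [Gen_b, Gen_a, Gen_c]) (P [Gen_a, Gen_b, Gen_a, Gen_c])"
proof -
  interpret M: assoc_algebra M by (rule assoc_algebra_module_mat)
  have carrier: "rep g1 g2 g3 v \<in> carrier M" for v
    using g by (cases v) (simp_all add: module_mat_simps)
  have scale: "nc_eval M (rep g1 g2 g3) (nc_const k * f) = k \<cdot>\<^sub>m nc_eval M (rep g1 g2 g3) f" for k f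
    using M.smult_mult_left[OF M.one_closed M.nc_eval_closed[where x = "rep g1 g2 g3", OF carrier], of k]
      M.l_one[OF M.nc_eval_closed[where x = "rep g1 g2 g3", OF carrier]]
    by (simp add: M.nc_eval_mult[where x = "rep g1 g2 g3", OF carrier]
        M.nc_eval_const[where x = "rep g1 g2 g3", OF carrier]
        module_mat_simps)
  have var: "nc_eval M (rep g1 g2 g3) (nc_var v * f) =
      rep g1 g2 g3 v * nc_eval M (rep g1 g2 g3) f" for v f
    by (simp add: M.nc_eval_mult[where x = "rep g1 g2 g3", OF carrier]
        M.nc_eval_var[where x = "rep g1 g2 g3", OF carrier] module_mat_simps)
  have 1: "g1 * 1\<^sub>m 2 = g1" "g2 * 1\<^sub>m 2 = g2" "g3 * 1\<^sub>m 2 = g3"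
    using g by auto
  show ?thesis
    by (simp add: normal_form_def D3_words_def generic_def scale var 1 module_mat_simps
        M.nc_eval_add[where x = "rep g1 g2 g3", OF carrier]
        M.nc_eval_const[where x = "rep g1 g2 g3", OF carrier]
        M.nc_eval_var[where x = "rep g1 g2 g3", OF carrier]
        M.nc_eval_1[where x = "rep g1 g2 g3", OF carrier] del: right_mult_one_mat)
qed

text \<open>For each of the three triples, both mixed sums consist of one square together with
  \<open>pq\<close> and \<open>qp\<close>, which gives \<open>s + \<beta>\<close>.\<close>

private lemma nc_eval_rep_relators:
  assumes g: "(g1, g2, g3) \<in> {(p, p, q), (p, q, q), (p, q, p)}"
    and f: "f \<in> D3_relators s (s + \<beta>)"
  shows "nc_eval M (rep g1 g2 g3) f = \<zero>\<^bsub>M\<^esub>"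
proof -
  interpret M: assoc_algebra M by (rule assoc_algebra_module_mat)
  have carrier: "rep g1 g2 g3 v \<in> carrier M" for v
    using g by (cases v) (auto simp: module_mat_simps mat22_carrier)
  note eval = M.nc_eval_add[where x = "rep g1 g2 g3", OF carrier]
    M.nc_eval_mult[where x = "rep g1 g2 g3", OF carrier]
    M.nc_eval_const[where x = "rep g1 g2 g3", OF carrier]
    M.nc_eval_var[where x = "rep g1 g2 g3", OF carrier]
    module_mat_simps
  have eqs: "g1 * g1 = s \<cdot>\<^sub>m 1\<^sub>m 2" "g2 * g2 = s \<cdot>\<^sub>m 1\<^sub>m 2" "g3 * g3 = s \<cdot>\<^sub>m 1\<^sub>m 2"
    "g3 * g1 + g2 * g3 + g1 * g2 = (s + \<beta>) \<cdot>\<^sub>m 1\<^sub>m 2"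
    "g3 * g2 + g2 * g1 + g1 * g3 = (s + \<beta>) \<cdot>\<^sub>m 1\<^sub>m 2"
    using g by (elim insertE emptyE; simp add: mat22_simps mat22_eq_iff algebra_simps)+
  have diff: "nc_eval M (rep g1 g2 g3) (h - nc_const k) = \<zero>\<^bsub>M\<^esub>"
    if "nc_eval M (rep g1 g2 g3) h = k \<cdot>\<^sub>m 1\<^sub>m 2" for h k
    by (rule M.nc_eval_diff_eq_0[where x = "rep g1 g2 g3", OF carrier]) (simp add: that eval)
  show ?thesis
    using f unfolding D3_relators_def Let_def
    by (elim insertE emptyE; hypsubst; intro diff) (simp_all add: eval eqs)
qed

text \<open>The representations kill the ideal and, by assumption, \<open>h\<close>; hence they kill
  the normal form, whose coefficients they separate.\<close>

lemma normal_form_coeffs_eq_0: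
  assumes ne: "\<beta> * \<beta> \<noteq> 4 * (r * r) * (r * r)"
    and h: "h - normal_form P \<in> D3_ideal (r * r) (r * r + \<beta>)"
    and kill: "\<And>y. (\<And>v. y v \<in> carrier_mat 2 2) \<Longrightarrow>
      nc_eval (module_mat TYPE('k) 2 2) y h = 0\<^sub>m 2 2"
    and vs: "vs \<in> D3_words"
  shows "P vs = 0"
proof -
  interpret M: assoc_algebra M by (rule assoc_algebra_module_mat)
  have rep_0: "nc_eval M (rep g1 g2 g3) (normal_form P) = 0\<^sub>m 2 2"
    if g: "(g1, g2, g3) \<in> {(p, p, q), (p, q, q), (p, q, p)}" for g1 g2 g3
  proof -
    have carrier: "rep g1 g2 g3 v \<in> carrier M" for v
      using g by (cases v) (auto simp: module_mat_simps mat22_carrier)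
    have "nc_eval M (rep g1 g2 g3) (h - normal_form P) = \<zero>\<^bsub>M\<^esub>"
      by (rule M.nc_eval_D3_ideal[where x = "rep g1 g2 g3", OF carrier nc_eval_rep_relators[OF g] h])
    moreover have "nc_eval M (rep g1 g2 g3) h = \<zero>\<^bsub>M\<^esub>"
      using kill[of "rep g1 g2 g3"] carrier by (simp add: module_mat_simps)
    ultimately have "nc_eval M (rep g1 g2 g3) (normal_form P) = \<zero>\<^bsub>M\<^esub>"
      by (rule M.nc_eval_eq_0_cong[where x = "rep g1 g2 g3", OF carrier])
    then show ?thesis by (simp add: module_mat_simps)
  qed
  note eval = nc_eval_rep_normal_form[OF mat22_carrier mat22_carrier mat22_carrier]
  show ?thesis
    using generic_eq_0[OF ne rep_0[OF insertI1, unfolded eval]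
        rep_0[OF insertI2[OF insertI1], unfolded eval]
        rep_0[OF insertI2[OF insertI2[OF insertI1]], unfolded eval]] vs
    by (auto simp: D3_words_def)
qed

end

section \<open>Membership in the ideal\<close>

text \<open>Over a finite field the product of all \<open>X - a\<close> vanishes everywhere, so
  adding 1 gives a nonconstant polynomial without roots.\<close>

lemma infinite_alg_closed_field: "infinite (UNIV :: 'k::alg_closed_field set)"
proof
  assume fin: "finite (UNIV :: 'k set)"
  define f :: "'k poly" where "f = (\<Prod>a\<in>UNIV. [:- a, 1:])"
  have "degree f = (\<Sum>a\<in>(UNIV :: 'k set). degree [:- a, 1:])"
    unfolding f_def by (rule degree_prod_eq_sum_degree) simp
  also have "\<dots> > 0"
    using fin by (simp add: card_gt_0_iff)
  finally have "degree (f + 1) > 0"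
    by (simp add: degree_add_eq_left)
  then obtain z where "poly (f + 1) z = 0"
    using alg_closed_imp_poly_has_root by blast
  moreover have "poly f z = 0"
    unfolding f_def using fin by (simp add: poly_prod prod_zero_iff)
  ultimately show False by simp
qed

text \<open>
  The representations separate normal forms for all but two values of \<open>\<alpha>\<^sub>2\<close>. As the coefficients are
  polynomials in \<open>\<alpha>\<^sub>2\<close>, the exceptional values are covered as well.
\<close>

lemma in_D3_ideal_if_matrices_kill:
  fixes h :: "(D3_gen, 'k::alg_closed_field) nc_poly"
  assumes kill: "\<And>y. (\<And>v. y v \<in> carrier_mat 2 2) \<Longrightarrow>
      nc_eval (module_mat TYPE('k) 2 2) y h = 0\<^sub>m 2 2"
  shows "h \<in> D3_ideal \<alpha>1 \<alpha>2"
proof -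
  obtain r where "r ^ 2 = \<alpha>1"
    using nth_root_exists[of 2 \<alpha>1] by auto
  then have r: "\<alpha>1 = r * r" by (simp add: power2_eq_square)
  \<comment> \<open>One choice of coefficient polynomials serves all \<open>t\<close> at
    once.\<close>
  obtain P where P: "h - normal_form (\<lambda>vs. poly (P vs) t) \<in> D3_ideal \<alpha>1 t" for t
    using reducible_nc_poly[of \<alpha>1 h] unfolding reducible_def by blast
  have P_0: "P vs = 0" if vs: "vs \<in> D3_words" for vs
  proof (rule ccontr)
    assume "P vs \<noteq> 0"
    \<comment> \<open>With \<open>\<beta> = t - \<alpha>1\<close>, the degenerate case
      \<open>\<beta> * \<beta> = 4 * \<alpha>1 * \<alpha>1\<close> occurs exactly at the two
      excluded values.\<close>
    have "poly (P vs) t = 0" if t: "t \<noteq> 3 * \<alpha>1" "t \<noteq> - \<alpha>1" for t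
    proof (rule normal_form_coeffs_eq_0[OF _ _ kill vs])
      have "(t - 3 * \<alpha>1) * (t + \<alpha>1) \<noteq> 0"
        using t by (simp add: eq_neg_iff_add_eq_0)
      moreover have "(t - 3 * \<alpha>1) * (t + \<alpha>1) = (t - \<alpha>1) * (t - \<alpha>1) - 4 * \<alpha>1 * \<alpha>1"
        by (simp add: algebra_simps)
      ultimately have "(t - \<alpha>1) * (t - \<alpha>1) \<noteq> 4 * \<alpha>1 * \<alpha>1"
        by (metis right_minus_eq)
      then show "(t - \<alpha>1) * (t - \<alpha>1) \<noteq> 4 * (r * r) * (r * r)"
        by (simp only: r[symmetric] not_False_eq_True)
      show "h - normal_form (\<lambda>vs. poly (P vs) t) \<in> D3_ideal (r * r) (r * r + (t - \<alpha>1))"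
        using P[of t] by (simp add: r)
    qed
    then have "UNIV \<subseteq> {t. poly (P vs) t = 0} \<union> {3 * \<alpha>1, - \<alpha>1}"
      by auto
    moreover have "finite ({t. poly (P vs) t = 0} \<union> {3 * \<alpha>1, - \<alpha>1})"
      using poly_roots_finite[OF \<open>P vs \<noteq> 0\<close>] by simp
    ultimately show False
      using infinite_alg_closed_field finite_subset by blast
  qed
  have "normal_form (\<lambda>vs. poly (P vs) \<alpha>2) = 0"
    by (simp add: normal_form_def P_0 nc_const_0)
  with P[of \<alpha>2] show ?thesis by simp
qed

section \<open>Transfer of identities\<close>

lemma assoc_algebra_hom_prod_algebra:
  assumes "\<And>i. i \<in> I \<Longrightarrow> assoc_algebra (A i)" "i \<in> I"
  shows "assoc_algebra_hom (prod_algebra I A) (A i) (\<lambda>x. x i)"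
proof -
  interpret P: assoc_algebra "prod_algebra I A"
    by (rule assoc_algebra_prod_algebra) (rule assms(1))
  interpret A: assoc_algebra "A i" by (rule assms)+
  have "(\<lambda>x. x i) \<in> Ring.ring_hom (prod_algebra I A) (A i)"
    using assms(2) by (intro ring_hom_memI) (auto simp: prod_algebra_def)
  then have "ring_hom_ring (prod_algebra I A) (A i) (\<lambda>x. x i)"
    by (rule ring_hom_ringI2[OF P.ring_axioms A.ring_axioms])
  then show ?thesis
    by (intro assoc_algebra_hom.intro assoc_algebra_hom_axioms.intro P.assoc_algebra_axioms
        A.assoc_algebra_axioms)
      (use assms(2) in \<open>simp_all add: prod_algebra_def\<close>)
qed

lemma zero_quot_algebra: "\<zero>\<^bsub>quot_algebra A I\<^esub> = I"
  by (simp add: quot_algebra_def FactRing_def)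

lemma (in assoc_algebra) carrier_quot_algebra:
  "carrier (quot_algebra A I) = (\<lambda>x. I +> x) ` carrier A"
  by (auto simp: quot_algebra_def FactRing_simps)

lemma (in assoc_algebra) assoc_algebra_hom_quot_algebra:
  assumes I: "ideal I A"
  shows "assoc_algebra_hom A (quot_algebra A I) (\<lambda>x. I +> x)"
proof -
  interpret I: ideal I A by fact
  interpret Q: assoc_algebra "quot_algebra A I" by (rule assoc_algebra_quot_algebra[OF I])
  have "(\<lambda>x. I +> x) \<in> Ring.ring_hom A (quot_algebra A I)"
    using I.rcos_ring_hom unfolding Ring.ring_hom_def quot_algebra_def by simp
  then have "ring_hom_ring A (quot_algebra A I) (\<lambda>x. I +> x)"
    by (rule ring_hom_ringI2[OF ring_axioms Q.ring_axioms])
  then show ?thesis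
    by (intro assoc_algebra_hom.intro assoc_algebra_hom_axioms.intro assoc_algebra_axioms
        Q.assoc_algebra_axioms)
      (simp_all add: smult_quot_algebra_coset[OF I])
qed

text \<open>Substitute diagonal tuples, constant over \<open>I\<close>, and project to the component
  \<open>i\<close>.\<close>

lemma polynomial_identity_factor:
  assumes A: "assoc_algebra A" and i: "i \<in> I"
    and f: "polynomial_identity m f (prod_algebra I (\<lambda>_. A))"
  shows "polynomial_identity m f A"
proof -
  let ?P = "prod_algebra I (\<lambda>_. A)"
  interpret h: assoc_algebra_hom ?P A "\<lambda>x. x i"
    by (rule assoc_algebra_hom_prod_algebra[OF A i])
  have "nc_eval A x f = \<zero>\<^bsub>A\<^esub>" if x: "x \<in> {1..m} \<rightarrow> carrier A" for x
  proof -
    let ?X = "\<lambda>v. \<lambda>j\<in>I. x v"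
    have X: "?X \<in> {1..m} \<rightarrow> carrier ?P"
      using x by (auto simp: prod_algebra_def)
    have "nc_eval A (\<lambda>v. ?X v i) f = nc_eval ?P ?X f i"
      by (rule h.hom_nc_eval[OF X, symmetric]) (use f in \<open>simp add: polynomial_identity_def\<close>)
    also have "\<dots> = \<zero>\<^bsub>A\<^esub>"
      using f X h.hom_zero by (simp add: polynomial_identity_def)
    finally show ?thesis using i by simp
  qed
  with f show ?thesis by (simp add: polynomial_identity_def)
qed

theorem corollary2p14:
  fixes \<alpha>1 \<alpha>2 :: "'k::alg_closed_field"
    and m :: nat and f :: "(nat, 'k) nc_poly"
  assumes "CHAR('k) \<noteq> 2"
    and "polynomial_identity m f (prod_algebra {1..3::nat} (\<lambda>_. module_mat TYPE('k) 2 2))"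
  shows "polynomial_identity m f (D3 \<alpha>1 \<alpha>2)"
proof -
  let ?F = "free_algebra UNIV :: ('k, (D3_gen, 'k) nc_poly) module"
  let ?M = "module_mat TYPE('k) 2 2"
  let ?I = "D3_ideal \<alpha>1 \<alpha>2"
  interpret F: assoc_algebra ?F by (rule assoc_algebra_free_algebra)
  interpret M: assoc_algebra ?M by (rule assoc_algebra_module_mat)
  have D3_eq: "D3 \<alpha>1 \<alpha>2 = quot_algebra ?F ?I"
    by (simp add: D3_def D3_ideal_def Let_def)
  interpret Q: assoc_algebra_hom ?F "D3 \<alpha>1 \<alpha>2" "\<lambda>x. ?I +>\<^bsub>?F\<^esub> x"
    unfolding D3_eq by (rule F.assoc_algebra_hom_quot_algebra[OF ideal_D3_ideal])
  have "polynomial_identity m f ?M"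
    by (rule polynomial_identity_factor[where i = 1, OF assoc_algebra_module_mat _ assms(2)]) simp
  then have f: "f \<in> carrier (free_algebra {1..m})"
    and identity: "\<And>z. z \<in> {1..m} \<rightarrow> carrier ?M \<Longrightarrow> nc_eval ?M z f = \<zero>\<^bsub>?M\<^esub>"
    by (simp_all add: polynomial_identity_def)
  have "nc_eval (D3 \<alpha>1 \<alpha>2) x f = \<zero>\<^bsub>D3 \<alpha>1 \<alpha>2\<^esub>" if x: "x \<in> {1..m} \<rightarrow> carrier (D3 \<alpha>1 \<alpha>2)" for x
  proof -
    have coset: "\<exists>g. x v = ?I +>\<^bsub>?F\<^esub> g" if "v \<in> {1..m}" for v
    proof -
      have "x v \<in> carrier (D3 \<alpha>1 \<alpha>2)" by (rule funcset_mem[OF x that])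
      then show ?thesis unfolding D3_eq F.carrier_quot_algebra by blast
    qed
    \<comment> \<open>Representatives in the free algebra; \<open>g\<close> is arbitrary outside
      \<open>{1..m}\<close>.\<close>
    obtain g where g: "x v = ?I +>\<^bsub>?F\<^esub> g v" if "v \<in> {1..m}" for v
      using coset by metis
    have gF: "g v \<in> carrier ?F" for v by (simp add: free_algebra_def)
    \<comment> \<open>A lift of the value of \<open>f\<close> at \<open>x\<close>, which therefore
      vanishes once \<open>h\<close> lies in the ideal.\<close>
    define h where "h = nc_eval ?F g f"
    have "h \<in> ?I"
    proof (rule in_D3_ideal_if_matrices_kill)
      fix y :: "D3_gen \<Rightarrow> 'k mat"
      assume "\<And>v. y v \<in> carrier_mat 2 2"
      then have y: "y v \<in> carrier ?M" for v by (simp add: module_mat_simps)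
      interpret y: assoc_algebra_hom ?F ?M "nc_eval ?M y"
        by (rule M.assoc_algebra_hom_nc_eval[OF y])
      \<comment> \<open>Substituting \<open>y\<close> into \<open>h\<close> amounts to evaluating
        \<open>f\<close> at the matrices obtained from the \<open>g v\<close>, where the identity
        applies.\<close>
      have "nc_eval ?M y h = nc_eval ?M (\<lambda>v. nc_eval ?M y (g v)) f"
        unfolding h_def by (rule y.hom_nc_eval[OF _ f]) (use gF in auto)
      also have "\<dots> = \<zero>\<^bsub>?M\<^esub>"
        by (rule identity) (use gF in auto)
      finally show "nc_eval ?M y h = 0\<^sub>m 2 2" by (simp add: module_mat_simps)
    qed
    have "nc_eval (D3 \<alpha>1 \<alpha>2) x f = nc_eval (D3 \<alpha>1 \<alpha>2) (\<lambda>v. ?I +>\<^bsub>?F\<^esub> g v) f"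
      by (rule assoc_algebra.nc_eval_cong[OF assoc_algebra_D3 g _ f]) (use gF in auto)
    also have "\<dots> = ?I +>\<^bsub>?F\<^esub> h"
      unfolding h_def by (rule Q.hom_nc_eval[symmetric, OF _ f]) (use gF in auto)
    also have "\<dots> = \<zero>\<^bsub>D3 \<alpha>1 \<alpha>2\<^esub>"
      unfolding D3_eq zero_quot_algebra by (rule F.a_rcos_zero[OF ideal_D3_ideal \<open>h \<in> ?I\<close>])
    finally show ?thesis .
  qed
  with f show ?thesis by (simp add: polynomial_identity_def)
qed

end
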